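(* Let $n \geq 6$ and let $F \subseteq \mathbb{N}$ be an arbitrary finite set such that either $F = \emptyset$ or $\min F \geq 3$. Then $Q_{U(F,n)} \geq \frac{5}{4}$. In particular, $Q_{R(n)} \geq \frac{5}{4}$ for every $n \geq 6$.
   Context: For a nonzero integer $N$, $\mathrm{rad}(N)$ denotes the largest square-free positive divisor of $N$. For $a = (a_1,\ldots,a_n) \in \mathbb{Z}^n$ with all $a_i \neq 0$, the quality of $a$ is $q(a) = \frac{\log(\max\{|a_1|,\ldots,|a_n|\})}{\log \mathrm{rad}(a_1 \cdots a_n)}$. For a set $A$ of such $n$-tuples, $Q_A$ denotes the limit superior of $q(a)$ over $a \in A$ (i.e. $\inf_{S \subseteq A \text{ finite}} \sup_{a \in A \setminus S} q(a)$). For $n \geq 3$ and a finite set $F \subseteq \mathbb{N}$ (with $\min F \geq 3$ if $F \neq \emptyset$), $U(F,n)$ is the set of all $(a_1,\ldots,a_n) \in \mathbb{Z}^n$ such that: (i) $\gcd(a_i,a_j) = 1$ for all $1 \leq i < j \leq n$; (ii) $a_1 + \cdots + a_n = 0$; (iii) there are no $b_1,\ldots,b_n \in \{-1,0,1\}$ and indices $i,j$ with $b_i = 0$, $b_j = 1$ and $\sum_{k=1}^n b_k a_k = 0$; (iv) none of $a_1,\ldots,a_n$ is a multiple of any element of $F$. $R(n)$ is the set of all $(a_1,\ldots,a_n) \in \mathbb{Z}^n$ such that: $a_1 + \cdots + a_n = 0$; there are no $b_1,\ldots,b_n \in \{0,1\}$ and indices $i,j$ with $b_i = 0$, $b_j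 = 1$ and $\sum_{k=1}^n b_k a_k = 0$; and $\gcd(a_i,a_j) = 1$ for all $1 \leq i < j \leq n$. *)

theory Defs
  imports
    "HOL-Analysis.Analysis"
    "HOL-Computational_Algebra.Squarefree"
begin

text \<open>
  An n-tuple of integers is an \<^typ>\<open>int list\<close> of length n; its entries are indexed from 0.
\<close>

definition rad :: "int \<Rightarrow> int" where
  "rad N = Max {d. d > 0 \<and> squarefree d \<and> d dvd N}"

text \<open>
  Only meaningful for nonempty tuples of nonzero integers, not all of absolute value 1
  (for the latter the denominator is \<^term>\<open>ln 1 = 0\<close>). The tuples of the sets
  defined below satisfy this whenever n is at least 3.
\<close>
definition quality :: "int list \<Rightarrow> real" where
  "quality a = ln (real_of_int (Max (abs ` set a))) / ln (real_of_int (rad (prod_list a)))"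

text \<open>Extended real valued, since the limit superior may be infinite (and is \<^term>\<open>-\<infinity>\<close> if A is finite).\<close>
definition limsup_quality :: "int list set \<Rightarrow> ereal" where
  "limsup_quality A = (INF S\<in>{S. S \<subseteq> A \<and> finite S}. SUP a\<in>A - S. ereal (quality a))"

definition pairwise_coprime_tuple :: "int list \<Rightarrow> bool" where
  "pairwise_coprime_tuple a \<longleftrightarrow> (\<forall>i j. i < j \<and> j < length a \<longrightarrow> gcd (a ! i) (a ! j) = 1)"

definition has_vanishing_subsum :: "int set \<Rightarrow> int list \<Rightarrow> bool" where
  "has_vanishing_subsum B a \<longleftrightarrow>
     (\<exists>b :: nat \<Rightarrow> int. (\<forall>k<length a. b k \<in> B) \<and>
        (\<exists>i<length a. \<exists>j<length a. b i = 0 \<and> b j = 1) \<and>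
        (\<Sum>k<length a. b k * a ! k) = 0)"

definition U_tuples :: "nat set \<Rightarrow> nat \<Rightarrow> int list set" where
  "U_tuples F n = {a. length a = n \<and>
     pairwise_coprime_tuple a \<and>
     sum_list a = 0 \<and>
     \<not> has_vanishing_subsum {-1, 0, 1} a \<and>
     (\<forall>x\<in>set a. \<forall>f\<in>F. \<not> int f dvd x)}"

definition R_tuples :: "nat \<Rightarrow> int list set" where
  "R_tuples n = {a. length a = n \<and>
     sum_list a = 0 \<and>
     \<not> has_vanishing_subsum {0, 1} a \<and>
     pairwise_coprime_tuple a}"

end

theory Submission
  imports Defs "HOL-Number_Theory.Cong" "HOL-Real_Asymp.Real_Asymp"
begin

text \<open>
  The construction rests on the identity
  (x + b)^5 - (x - b)^5 - (10 b - 1) x^4 - (x^2 + 10 b^3)^2 + (100 b^6 - 2 b^5) = 0.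
  If x runs through the powers of a fixed integer g, then x^4 contributes only a constant to the
  radical, so the radical is O(x^4) while the largest entry is at least x^5; this gives 5/4.
  The constant 100 b^6 - 2 b^5 is split into n - 4 pairwise coprime summands of rapidly growing size.
  Taking b divisible by all elements of F and g congruent to 1 modulo the relevant constants makes
  the entries coprime to each other and not divisible by elements of F. Comparing digits in base x,
  a vanishing combination with coefficients -1, 0, 1 has equal coefficients at the four
  non-constant entries, and then the growth of the constants forces all coefficients to be equal.
\<close>

section \<open>Rapidly decreasing sequences and their small integer combinations\<close>

text \<open>The factor 2 matches differences of coefficients: two elements of {-1, 0, 1} differ by
  at most 2.\<close>

fun lacunary :: "int list \<Rightarrow> bool" where
  "lacunary [] \<longleftrightarrow> True"
| "lacunary (c # cs) \<longleftrightarrow> 2 * sum_list cs < c \<and> lacunary cs"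

lemma abs_sum_mult_le:
  assumes "\<forall>c\<in>set cs. c > 0" and "\<forall>k<length cs. \<bar>\<beta> k\<bar> \<le> m"
  shows "\<bar>\<Sum>k<length cs. \<beta> k * cs ! k\<bar> \<le> m * sum_list (cs :: int list)"
proof -
  have "\<bar>\<Sum>k<length cs. \<beta> k * cs ! k\<bar> \<le> (\<Sum>k<length cs. \<bar>\<beta> k * cs ! k\<bar>)"
    by (rule sum_abs)
  also have "\<dots> \<le> (\<Sum>k<length cs. m * cs ! k)"
  proof (rule sum_mono)
    fix k assume "k \<in> {..<length cs}"
    then have "cs ! k > 0" "\<bar>\<beta> k\<bar> \<le> m" using assms by auto
    then show "\<bar>\<beta> k * cs ! k\<bar> \<le> m * cs ! k"
      by (simp add: abs_mult mult_right_mono)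
  qed
  also have "\<dots> = m * sum_list cs"
    by (simp add: sum_list_sum_nth sum_distrib_left atLeast0LessThan)
  finally show ?thesis .
qed

text \<open>The later terms together stay below the first entry in absolute value, so the integer
  coefficient of that entry must vanish; induction removes the others.\<close>

lemma lacunary_sum_eq_0:
  assumes "lacunary cs" and "\<forall>c\<in>set cs. c > 0" and "\<forall>k<length cs. \<bar>\<beta> k\<bar> \<le> 2"
    and "(\<Sum>k<length cs. \<beta> k * cs ! k) = 0"
  shows "\<forall>k<length cs. \<beta> k = 0"
  using assms
proof (induction cs arbitrary: \<beta>)
  case Nil
  then show ?case by simp
next
  case (Cons c cs)
  let ?r = "\<Sum>k<length cs. \<beta> (Suc k) * cs ! k"
  have eq: "\<beta> 0 * c + ?r = 0"
    using Cons.prems(4) by (simp add: sum.lessThan_Suc_shift del: sum.lessThan_Suc)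
  have "\<bar>?r\<bar> \<le> 2 * sum_list cs"
    using Cons.prems(2,3) by (intro abs_sum_mult_le) auto
  then have "\<bar>\<beta> 0 * c\<bar> < c" using eq Cons.prems(1) by (simp add: add_eq_0_iff2)
  then have b0: "\<beta> 0 = 0"
    using Cons.prems(2)
    by (auto simp: abs_mult mult_less_cancel_right2)
  then have "?r = 0" using eq by simp
  then have "\<forall>k<length cs. \<beta> (Suc k) = 0"
    using Cons.prems by (intro Cons.IH[of "\<lambda>k. \<beta> (Suc k)"]) auto
  with b0 show ?case by (auto simp: less_Suc_eq_0_disj)
qed

section \<open>Pairwise coprime constants with prescribed residues\<close>

lemma exists_large_cong:
  fixes m n :: int
  assumes "coprime m n" and "m > 0" and "n > 0"
  shows "\<exists>c>B. [c = u] (mod m) \<and> [c = v] (mod n)"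
proof -
  obtain c where c: "[c = u] (mod m)" "[c = v] (mod n)"
    using binary_chinese_remainder_int[OF assms(1)] by blast
  \<comment> \<open>Adding a multiple of \<open>m * n\<close> keeps both residues and pushes the
    solution above \<open>B\<close>.\<close>
  define c' where "c' = c + m * n * (\<bar>B\<bar> + \<bar>c\<bar> + 1)"
  have "1 * (\<bar>B\<bar> + \<bar>c\<bar> + 1) \<le> m * n * (\<bar>B\<bar> + \<bar>c\<bar> + 1)"
    using assms by (intro mult_right_mono) (auto simp: int_one_le_iff_zero_less)
  then have "c' > B" unfolding c'_def by (smt (verit))
  moreover have "[c' = u] (mod m)" using c(1) unfolding c'_def cong_def by (simp add: mult.assoc)
  moreover have "[c' = v] (mod n)" using c(2) unfolding c'_def cong_def
    by (simp add: mult.assoc mult.left_commute[of m n])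
  ultimately show ?thesis by blast
qed

lemma coprime_cong_unit:
  fixes c :: int
  assumes "[c = \<epsilon>] (mod m)" and "\<bar>\<epsilon>\<bar> = 1"
  shows "coprime c m"
proof -
  have "coprime \<epsilon> m" using assms(2) by (intro is_unit_left_imp_coprime) simp
  then show ?thesis using assms(1) cong_imp_coprime cong_sym by blast
qed

text \<open>A new entry congruent to the sum T of the old ones modulo each of them turns their sum into
  2 T, and being a unit modulo L T keeps it coprime to the new sum.\<close>
lemma exists_lacunary_coprime_list:
  fixes L :: int
  assumes "L > 0" and "even L"
  shows "\<exists>cs. length cs = Suc k \<and> (\<forall>c\<in>set cs. c > 0) \<and> lacunary cs \<and> sorted_wrt coprime cs \<and>
    (\<forall>c\<in>set cs. coprime c L \<and> coprime c (sum_list cs)) \<and>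
    [sum_list cs = (if even k then 1 else 2)] (mod L)"
proof (induction k)
  case 0
  show ?case by (intro exI[of _ "[1]"]) simp
next
  case (Suc k)
  then obtain cs where len: "length cs = Suc k" and pos: "\<forall>c\<in>set cs. c > 0" and lac: "lacunary cs"
    and cop: "sorted_wrt coprime cs" and cL: "\<forall>c\<in>set cs. coprime c L"
    and cT: "\<forall>c\<in>set cs. coprime c (sum_list cs)"
    and T: "[sum_list cs = (if even k then 1 else 2)] (mod L)"
    by auto
  define T where "T = sum_list cs"
  \<comment> \<open>The sign lets the sum modulo \<open>L\<close> alternate between 1 and 2: 1 + 1 =
    2 and 2 - 1 = 1.\<close>
  define \<epsilon> :: int where "\<epsilon> = (if even k then 1 else -1)"
  have Tpos: "T > 0" using len pos unfolding T_def
    by (cases cs) (auto intro!: add_pos_nonneg sum_list_nonneg simp: less_imp_le)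
  have Cpos: "prod_list cs > 0" using pos by (induction cs) auto
  have "coprime (L * T) (prod_list cs)"
    using cL cT unfolding T_def[symmetric]
    by (intro prod_list_coprime_right) (auto simp: coprime_commute)
  then obtain c where c: "c > 2 * T" "[c = \<epsilon>] (mod L * T)" "[c = T] (mod prod_list cs)"
    using exists_large_cong assms Tpos Cpos by (metis mult_pos_pos)
  have cLT: "coprime c (L * T)"
    using c(2) by (rule coprime_cong_unit) (simp add: \<epsilon>_def)
  have cc: "coprime c d \<and> coprime d (c + T)" if d: "d \<in> set cs" for d
  proof -
    have "[c = T] (mod d)" using c(3) d by (meson cong_dvd_modulus prod_list_dvd)
    then have "[c + T = 2 * T] (mod d)" by (metis cong_add_rcancel mult_2)
    moreover have "coprime d T" "coprime d 2" using cT cL d assms(2)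
      unfolding T_def by (auto simp: coprime_commute intro: coprime_divisors)
    ultimately show ?thesis using \<open>[c = T] (mod d)\<close>
      by (metis cong_imp_coprime cong_sym coprime_commute coprime_mult_right_iff)
  qed
  have "[c + T = \<epsilon> + (if even k then 1 else 2)] (mod L)"
    using c(2) T unfolding T_def by (intro cong_add) (auto intro: cong_modulus_mult)
  then have "[c + T = (if even (Suc k) then 1 else 2)] (mod L)"
    by (auto simp: \<epsilon>_def split: if_splits)
  moreover have "coprime c (c + T)" using cLT
    by (metis coprime_iff_gcd_eq_1 coprime_mult_right_iff gcd_add2)
  ultimately show ?case
    using len pos lac cop cL cc c(1) cLT Tpos
    by (intro exI[of _ "c # cs"]) (auto simp: T_def[symmetric])
qed

section \<open>Choice of the parameters \<open>b\<close>, \<open>s\<close> and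
  \<open>cs\<close>\<close>

text \<open>A common divisor of \<open>p\<close> and \<open>q\<close> divides \<open>r\<close>,
  hence \<open>b\<close>, to which \<open>p\<close> is coprime. In most applications
  \<open>p\<close> and \<open>q\<close> are polynomials in \<open>b\<close>, and \<open>r\<close> is
  their resultant up to a constant factor.\<close>

lemma coprime_by_combination:
  fixes p q r b :: int
  assumes "coprime p b" and "r dvd b" and "u * p + v * q = r"
  shows "coprime p q"
proof (rule coprimeI)
  fix d assume "d dvd p" "d dvd q"
  then have "d dvd r" using assms(3) by (metis dvd_add dvd_mult)
  then show "is_unit d" using assms \<open>d dvd p\<close> by (meson coprime_common_divisor dvd_trans)
qed

text \<open>
  The number 99990 = 2 * 5 * 9 * 11 * 101 collects the small common divisors that two entries
  of the tuple below could have.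
\<close>
locale tuple_parameters =
  fixes L b s :: int and cs :: "int list" and k :: nat
  assumes length_cs: "length cs = Suc k"
    and L_pos: "L > 0" and b_pos: "b > 0" and L_dvd_b: "L dvd b"
    and dvd_L: "99990 dvd L"
    and pos: "\<forall>c\<in>set (s # cs). c > 0"
    and lacunary: "lacunary (s # cs)"
    and coprime_constants: "sorted_wrt coprime (s # cs)"
    and sum_constants: "s + sum_list cs = 100 * b ^ 6 - 2 * b ^ 5"
    and cs_coprime_L: "\<forall>c\<in>set cs. coprime c L"
    and cs_dvd_b: "\<forall>c\<in>set cs. c dvd b"
    and s_cong: "[s = (if even k then -1 else -2)] (mod L)"
    and coprime_s: "coprime (1 + b) s" "coprime (1 - b) s" "coprime (10 * b - 1) s"
      "coprime (1 + 10 * b ^ 3) s"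

text \<open>\<open>s\<close> is what remains of 100 b^6 - 2 b^5 after subtracting the sum T of
  \<open>cs\<close>. As \<open>b\<close> is a multiple of \<open>L\<close> and of every entry of
  \<open>cs\<close>, \<open>s\<close> is congruent to -T modulo each of them, so the residue and
  coprimality properties of T pass to \<open>s\<close>.\<close>

lemma exists_tuple_parameters:
  fixes L :: int
  assumes "L > 0" and L: "99990 dvd L"
  shows "\<exists>b s cs. tuple_parameters L b s cs k"
proof -
  have "even L" using L by (rule dvd_trans[rotated]) simp
  obtain cs where len: "length cs = Suc k" and pos: "\<forall>c\<in>set cs. c > 0" and lac: "lacunary cs"
    and cop: "sorted_wrt coprime cs" and cL: "\<forall>c\<in>set cs. coprime c L"
    and cT: "\<forall>c\<in>set cs. coprime c (sum_list cs)"
    and T: "[sum_list cs = (if even k then 1 else 2)] (mod L)"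
    using exists_lacunary_coprime_list[OF \<open>L > 0\<close> \<open>even L\<close>] by blast
  define T where "T = sum_list cs"
  \<comment> \<open>The last four factors are the resultants, in b, of the polynomial defining s and the
    polynomials 1 + b, 1 - b, 10 b - 1 and 1 + 10 b^3, up to constant factors.\<close>
  define b where "b = \<bar>L * prod_list cs * T * (102 - T) * (98 - T) * (80 - 10 ^ 6 * T) *
    (12500 * (T - 1) ^ 3 - 1)\<bar>"
  define s where "s = 100 * b ^ 6 - 2 * b ^ 5 - T"
  have Tpos: "T > 0" using len pos unfolding T_def
    by (cases cs) (auto intro!: add_pos_nonneg sum_list_nonneg simp: less_imp_le)
  have Cpos: "prod_list cs > 0" using pos by (induction cs) auto
  \<comment> \<open>This keeps two factors of \<open>b\<close> nonzero: T is 1 or 2 modulo 9,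
    whereas 102 and 98 are 3 and 8.\<close>
  have "[T = (if even k then 1 else 2)] (mod 9)"
    using T L unfolding T_def by (elim cong_dvd_modulus dvd_trans[rotated]) simp
  then have "T \<noteq> 102" "T \<noteq> 98" by (auto simp: cong_def split: if_splits)
  moreover have "80 - 10 ^ 6 * T \<noteq> 0" using Tpos by simp
  moreover have "odd (12500 * (T - 1) ^ 3 - 1)" by simp
  then have "12500 * (T - 1) ^ 3 - 1 \<noteq> 0" by (metis even_zero)
  ultimately have bpos: "b > 0" using \<open>L > 0\<close> Cpos Tpos by (auto simp: b_def)
  have dvd: "L dvd b" "prod_list cs dvd b" "T dvd b" "102 - T dvd b" "98 - T dvd b" "80 - 10 ^ 6 * T dvd b"
    "12500 * (T - 1) ^ 3 - 1 dvd b"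
    by (simp_all add: b_def mult.assoc)
  have "T \<le> b" using dvd(3) bpos by (simp add: zdvd_imp_le)
  have "b ^ 1 \<le> b ^ 5" "b ^ 5 \<le> b ^ 6" using bpos by (intro power_increasing; simp)+
  then have s: "s > 2 * T" using \<open>T \<le> b\<close> Tpos by (simp add: s_def)
  have cs_b: "c dvd b" if "c \<in> set cs" for c
    using that dvd(2) by (meson prod_list_dvd dvd_trans)
  have cs_s: "coprime s c" if c: "c \<in> set cs" for c
  proof -
    have "c dvd s - (- T)" using cs_b[OF c] unfolding s_def by (simp add: dvd_diff power_numeral_reduce)
    then have "[s = - T] (mod c)" by (simp add: cong_iff_dvd_diff)
    moreover have "coprime (- T) c" using cT c by (simp add: T_def coprime_commute)
    ultimately show ?thesis using cong_imp_coprime cong_sym by blast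
  qed
  have "[s = 0 - (if even k then 1 else 2)] (mod L)"
    unfolding s_def using T dvd(1) unfolding T_def
    by (intro cong_diff) (auto simp: cong_0_iff dvd_diff power_numeral_reduce)
  then have s_cong: "[s = (if even k then -1 else -2)] (mod L)" by (auto split: if_splits)
  have b1: "coprime (1 + b) b" "coprime (1 - b) b" "coprime (10 * b - 1) b" "coprime (1 + 10 * b ^ 3) b"
    by (rule coprime_cong_unit[of _ 1] coprime_cong_unit[of _ "-1"];
      simp add: cong_iff_dvd_diff power_numeral_reduce)+
  \<comment> \<open>Here and in the next two claims the long multiplier is the negated quotient of
    \<open>s\<close> (of \<open>10^6 * s\<close> in the third) by the linear polynomial. The
    remainder is the value at its root: b = -1, 1, 1/10.\<close>
  have "coprime (1 + b) s"
    by (rule coprime_by_combination[OF b1(1) dvd(4),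
        of "- (100 * b^5 - 102 * b^4 + 102 * b^3 - 102 * b^2 + 102 * b - 102)" 1])
      (simp add: s_def algebra_simps power_numeral_reduce)
  moreover have "coprime (1 - b) s"
    by (rule coprime_by_combination[OF b1(2) dvd(5),
        of "100 * b^5 + 98 * b^4 + 98 * b^3 + 98 * b^2 + 98 * b + 98" 1])
      (simp add: s_def algebra_simps power_numeral_reduce)
  moreover have "coprime (10 * b - 1) s"
    by (rule coprime_by_combination[OF b1(3) dvd(6),
        of "- (10^7 * b^5 + 8 * 10^5 * b^4 + 8 * 10^4 * b^3 + 8000 * b^2 + 800 * b + 80)" "10^6"])
      (simp add: s_def algebra_simps power_numeral_reduce)
  moreover have "coprime (1 + 10 * b ^ 3) s"
  proof (rule coprimeI)
    fix d assume d: "d dvd 1 + 10 * b ^ 3" "d dvd s"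
    \<comment> \<open>Elimination of \<open>b\<close> modulo \<open>d\<close>: 10 b^3 = -1 turns 5 s
      into b^2 - 5 (T - 1). Cubing b^2 and using 100 b^6 = 1 leaves a number depending on T
      alone.\<close>
    have "b ^ 2 - 5 * (T - 1) = 5 * s - (1 + 10 * b ^ 3) * (5 * (10 * b ^ 3 - 1) - b ^ 2)"
      by (simp add: s_def algebra_simps power_numeral_reduce)
    then have "[b ^ 2 = 5 * (T - 1)] (mod d)"
      using d by (simp add: cong_iff_dvd_diff)
    then have "[100 * (b ^ 2) ^ 3 - 1 = 100 * (5 * (T - 1)) ^ 3 - 1] (mod d)"
      by (intro cong_diff cong_mult cong_pow cong_refl)
    moreover have "100 * (b ^ 2) ^ 3 - 1 = (1 + 10 * b ^ 3) * (10 * b ^ 3 - 1)"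
      by (simp add: algebra_simps power_numeral_reduce)
    then have "d dvd 100 * (b ^ 2) ^ 3 - 1" using d(1) by simp
    ultimately have "d dvd 100 * (5 * (T - 1)) ^ 3 - 1"
      using cong_dvd_iff by blast
    also have "100 * (5 * (T - 1)) ^ 3 - 1 = 12500 * (T - 1) ^ 3 - 1"
      by (simp add: algebra_simps power_numeral_reduce)
    finally have "d dvd b" using dvd(7) by (rule dvd_trans)
    then show "is_unit d" using b1(4) d(1) coprime_common_divisor by blast
  qed
  ultimately have "tuple_parameters L b s cs k"
    using len \<open>L > 0\<close> bpos dvd(1) L pos s Tpos lac cop cs_s cL cs_b s_cong
    by unfold_locales (auto simp: T_def s_def)
  then show ?thesis by blast
qed

section \<open>The tuple and its membership in \<open>U_tuples\<close>\<close>

lemma digit_eq_0: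
  fixes d q x :: int
  assumes "d + x * q = 0" and "\<bar>d\<bar> < x"
  shows "d = 0" "q = 0"
proof -
  have "x dvd d" using assms(1) by (metis dvd_add_left_iff dvd_triv_left dvd_0_right)
  then show "d = 0" using assms(2) by (meson dvd_imp_le_int not_less abs_ge_self order_trans)
  then show "q = 0" using assms by auto
qed

context tuple_parameters
begin

definition tuple :: "int \<Rightarrow> int list" where
  "tuple x = [(x + b) ^ 5, - ((x - b) ^ 5), - ((10 * b - 1) * x ^ 4), - ((x ^ 2 + 10 * b ^ 3) ^ 2)]
     @ s # cs"

text \<open>For x congruent to 1 modulo this number, coprimality to each factor can be tested at x =
  1. The factor 10 b + 1 serves the pairs formed by the fourth entry with the first two.\<close>

definition modulus :: int where
  "modulus = b * (10 * b - 1) * (10 * b + 1) * s"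

lemma length_tuple: "length (tuple x) = k + 6"
  by (simp add: tuple_def length_cs)

lemma sum_list_tuple: "sum_list (tuple x) = 0"
  using sum_constants by (simp add: tuple_def) (simp add: algebra_simps power_numeral_reduce)

lemma dvd_b: "r dvd 99990 \<Longrightarrow> r dvd b"
  using dvd_L L_dvd_b by (meson dvd_trans)

text \<open>At x = 1 all these numbers reduce to 1 or -1 modulo \<open>b\<close>.\<close>

lemma tuple_coprime_b:
  assumes "[x = 1] (mod modulus)"
  shows "coprime (x + b) b" "coprime (x - b) b" "coprime x b" "coprime (10 * b - 1) b"
    "coprime (x ^ 2 + 10 * b ^ 3) b"
proof -
  have x: "[x = 1] (mod b)"
    using assms unfolding modulus_def by (auto intro: cong_modulus_mult simp: mult.assoc)
  show "coprime x b" using x by (rule coprime_cong_unit) simp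
  have "[x + b = 1 + 0] (mod b)" "[x - b = 1 - 0] (mod b)" "[10 * b - 1 = 0 - 1] (mod b)"
    "[x ^ 2 + 10 * b ^ 3 = 1 ^ 2 + 0] (mod b)"
    by (intro cong_add cong_diff cong_pow x; simp add: cong_0_iff)+
  then show "coprime (x + b) b" "coprime (x - b) b" "coprime (10 * b - 1) b"
    "coprime (x ^ 2 + 10 * b ^ 3) b"
    by (auto intro: coprime_cong_unit)
qed

lemma sorted_coprime_tuple:
  assumes "[x = 1] (mod modulus)"
  shows "sorted_wrt coprime (tuple x)"
proof -
  note cb = tuple_coprime_b[OF assms]
  have x: "[x = 1] (mod 10 * b - 1)" "[x = 1] (mod 10 * b + 1)" "[x = 1] (mod s)"
    using assms by (rule cong_dvd_modulus; simp add: modulus_def)+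
  have s: "coprime (x + b) s" "coprime (x - b) s" "coprime x s" "coprime (x ^ 2 + 10 * b ^ 3) s"
  proof -
    have "[x + b = 1 + b] (mod s)" "[x - b = 1 - b] (mod s)"
      "[x ^ 2 + 10 * b ^ 3 = 1 ^ 2 + 10 * b ^ 3] (mod s)"
      by (intro cong_add cong_diff cong_pow x cong_refl)+
    then show "coprime (x + b) s" "coprime (x - b) s" "coprime (x ^ 2 + 10 * b ^ 3) s"
      using coprime_s by (auto intro: cong_imp_coprime cong_sym)
    show "coprime x s" using x(3) by (rule coprime_cong_unit) simp
  qed
  have e: "coprime (10 * b - 1) (x + b)" "coprime (10 * b - 1) (x - b)" "coprime (10 * b - 1) x"
    "coprime (10 * b - 1) (x ^ 2 + 10 * b ^ 3)"
  proof -
    have "[x + b = 1 + b] (mod 10 * b - 1)" "[x - b = 1 - b] (mod 10 * b - 1)"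
      "[x ^ 2 + 10 * b ^ 3 = 1 ^ 2 + 10 * b ^ 3] (mod 10 * b - 1)"
      by (intro cong_add cong_diff cong_pow x cong_refl)+
    \<comment> \<open>Eliminating \<open>b\<close> leaves 11, 9 and 101 in these three claims, all
      divisors of 99990 and so of \<open>b\<close>.\<close>
    moreover have "coprime (10 * b - 1) (1 + b)"
      by (rule coprime_by_combination[OF cb(4) dvd_b, of 11 "-1" 10]) simp_all
    moreover have "coprime (10 * b - 1) (1 - b)"
      by (rule coprime_by_combination[OF cb(4) dvd_b, of 9 1 10]) simp_all
    moreover have "coprime (10 * b - 1) (1 + 10 * b ^ 3)"
      by (rule coprime_by_combination[OF cb(4) dvd_b, of 101 "- (100 * b ^ 2 + 10 * b + 1)" 100])
        (simp_all add: algebra_simps power_numeral_reduce)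
    ultimately show "coprime (10 * b - 1) (x + b)" "coprime (10 * b - 1) (x - b)"
        "coprime (10 * b - 1) (x ^ 2 + 10 * b ^ 3)"
      by (auto simp: coprime_commute[of "10 * b - 1"] intro: cong_imp_coprime cong_sym)
    show "coprime (10 * b - 1) x" using x(1) coprime_cong_unit coprime_commute by (metis abs_1)
  qed
  have b1: "coprime (10 * b + 1) b"
    by (rule coprime_cong_unit[of _ 1]) (simp_all add: cong_iff_dvd_diff)
  \<comment> \<open>Modulo x + b and x - b, x^2 equals b^2, so x^2 + 10 b^3 becomes b^2 (10 b + 1).
    Coprimality to 10 b + 1 is tested at x = 1, with leftovers 9 and 11.\<close>
  have w: "coprime (x + b) (x ^ 2 + 10 * b ^ 3)" "coprime (x - b) (x ^ 2 + 10 * b ^ 3)"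
  proof -
    have "[x + b = 1 + b] (mod 10 * b + 1)" "[x - b = 1 - b] (mod 10 * b + 1)"
      by (intro cong_add cong_diff x cong_refl)+
    moreover have "coprime (10 * b + 1) (1 + b)"
      by (rule coprime_by_combination[OF b1 dvd_b, of 9 "-1" 10]) simp_all
    moreover have "coprime (10 * b + 1) (1 - b)"
      by (rule coprime_by_combination[OF b1 dvd_b, of 11 1 10]) simp_all
    ultimately have "coprime (x + b) (10 * b + 1)" "coprime (x - b) (10 * b + 1)"
      by (auto simp: coprime_commute[of "10 * b + 1"] intro: cong_imp_coprime cong_sym)
    then have "coprime (x + b) (b ^ 2 * (10 * b + 1))" "coprime (x - b) (b ^ 2 * (10 * b + 1))"
      using cb by auto
    moreover have "x ^ 2 + 10 * b ^ 3 - b ^ 2 * (10 * b + 1) = (x + b) * (x - b)"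
      by (simp add: algebra_simps power_numeral_reduce)
    then have "[x ^ 2 + 10 * b ^ 3 = b ^ 2 * (10 * b + 1)] (mod (x + b))"
      "[x ^ 2 + 10 * b ^ 3 = b ^ 2 * (10 * b + 1)] (mod (x - b))"
      by (simp_all add: cong_iff_dvd_diff)
    ultimately show "coprime (x + b) (x ^ 2 + 10 * b ^ 3)" "coprime (x - b) (x ^ 2 + 10 * b ^ 3)"
      by (metis cong_imp_coprime cong_sym coprime_commute)+
  qed
  have "even b" by (rule dvd_b) simp
  \<comment> \<open>The difference is 2 b, and x + b is odd because it is coprime to the even number
    \<open>b\<close>.\<close>
  have ab: "coprime (x + b) (x - b)"
    by (rule coprime_by_combination[of _ "2 * b", OF _ dvd_refl, of _ 1 "- 1"])
      (use cb(1) \<open>even b\<close> coprime_divisors[of "x + b" "x + b" 2 b] in \<open>simp_all del: coprime_right_2_iff_odd\<close>)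
  have xb: "coprime (x + b) x" "coprime (x - b) x"
    using cb coprime_by_combination[of "x + b" b b 1 "- 1" x] coprime_by_combination[of "x - b" b b "- 1" 1 x]
    by simp_all
  have xw: "coprime x (x ^ 2 + 10 * b ^ 3)"
  proof (rule coprime_by_combination[of x "10 * b ^ 3" "10 * b ^ 3" "- x" 1])
    have "coprime x 10" using cb(3) dvd_b[of 10] coprime_divisors[of x x 10 b] by simp
    then show "coprime x (10 * b ^ 3)" using cb(3) by auto
  qed (simp_all add: power2_eq_square)
  have "coprime (x + b) c" "coprime (x - b) c" "coprime x c" "coprime (10 * b - 1) c"
    "coprime (x ^ 2 + 10 * b ^ 3) c" if "c \<in> set cs" for c
    using cb cs_dvd_b that by (meson coprime_divisors dvd_refl)+
  then show ?thesis
    using s e w ab xb xw coprime_s(3) coprime_constants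
    by (auto simp: tuple_def coprime_commute[of _ "10 * b - 1"] coprime_commute[of x "x + b"])
qed

text \<open>The bound on \<open>x\<close> makes the coefficients of x^0 to x^4 in the combination
  smaller than \<open>x\<close>, so \<open>digit_eq_0\<close> forces them to vanish one after the
  other, and finally that of x^5.\<close>

lemma no_vanishing_subsum_tuple:
  assumes "x > 1000 * b ^ 6"
  shows "\<not> has_vanishing_subsum {-1, 0, 1} (tuple x)"
proof
  assume "has_vanishing_subsum {-1, 0, 1} (tuple x)"
  then obtain \<beta> :: "nat \<Rightarrow> int" and i j where \<beta>: "\<forall>k<length (tuple x). \<beta> k \<in> {-1, 0, 1}"
    and ij: "i < length (tuple x)" "j < length (tuple x)" "\<beta> i = 0" "\<beta> j = 1"
    and sum: "(\<Sum>k<length (tuple x). \<beta> k * tuple x ! k) = 0"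
    unfolding has_vanishing_subsum_def by blast
  define ds where "ds = s # cs"
  define R where "R = (\<Sum>k<length ds. \<beta> (k + 4) * ds ! k)"
  have len: "length (tuple x) = length ds + 4" by (simp add: tuple_def ds_def)
  have \<beta>_le: "\<bar>\<beta> k\<bar> \<le> 1" if "k < length ds + 4" for k using \<beta> that len by force
  have bt: "\<bar>\<beta> k * t\<bar> \<le> t" if "k < 4" "t \<ge> 0" for k t
    using \<beta>_le[of k] that by (simp add: abs_mult mult_left_le_one_le)
  have sum_ds: "sum_list ds = 100 * b ^ 6 - 2 * b ^ 5" using sum_constants by (simp add: ds_def)
  have "\<bar>R\<bar> \<le> 1 * sum_list ds"
    unfolding R_def using pos \<beta>_le by (intro abs_sum_mult_le) (auto simp: ds_def)
  then have R: "\<bar>R\<bar> \<le> 100 * b ^ 6"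
    using sum_ds b_pos zero_less_power[of b 5] by linarith
  have pw: "b ^ m \<le> b ^ 6" if "m \<le> 6" for m using b_pos that by (intro power_increasing) auto
  have eq: "\<beta> 0 * (x + b) ^ 5 - \<beta> 1 * (x - b) ^ 5 - \<beta> 2 * ((10 * b - 1) * x ^ 4)
      - \<beta> 3 * (x ^ 2 + 10 * b ^ 3) ^ 2 + R = 0"
    using sum unfolding R_def ds_def tuple_def
    by (simp add: sum.lessThan_Suc_shift numeral_eq_Suc algebra_simps del: sum.lessThan_Suc power_Suc)
  define d0 d1 d2 d3 d4 d5 where d: "d0 = \<beta> 0 * b ^ 5 + \<beta> 1 * b ^ 5 - \<beta> 3 * (100 * b ^ 6) + R"
    "d1 = \<beta> 0 * (5 * b ^ 4) - \<beta> 1 * (5 * b ^ 4)"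
    "d2 = \<beta> 0 * (10 * b ^ 3) + \<beta> 1 * (10 * b ^ 3) - \<beta> 3 * (20 * b ^ 3)"
    "d3 = \<beta> 0 * (10 * b ^ 2) - \<beta> 1 * (10 * b ^ 2)"
    "d4 = \<beta> 0 * (5 * b) + \<beta> 1 * (5 * b) - \<beta> 2 * (10 * b - 1) - \<beta> 3"
    "d5 = \<beta> 0 - \<beta> 1"
  have eq': "d0 + x * (d1 + x * (d2 + x * (d3 + x * (d4 + x * d5)))) = 0"
    using eq unfolding d by (simp add: algebra_simps power_numeral_reduce)
  have bd: "\<bar>d0\<bar> < x" "\<bar>d1\<bar> < x" "\<bar>d2\<bar> < x" "\<bar>d3\<bar> < x" "\<bar>d4\<bar> < x"
  proof -
    note p = pw[of 1] pw[of 2] pw[of 3] pw[of 4] pw[of 5] b_pos assms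
    show "\<bar>d0\<bar> < x" using bt[of 0 "b ^ 5"] bt[of 1 "b ^ 5"] bt[of 3 "100 * b ^ 6"] R p unfolding d by simp
    show "\<bar>d1\<bar> < x" using bt[of 0 "5 * b ^ 4"] bt[of 1 "5 * b ^ 4"] p unfolding d by simp
    show "\<bar>d2\<bar> < x" using bt[of 0 "10 * b ^ 3"] bt[of 1 "10 * b ^ 3"] bt[of 3 "20 * b ^ 3"] p unfolding d by simp
    show "\<bar>d3\<bar> < x" using bt[of 0 "10 * b ^ 2"] bt[of 1 "10 * b ^ 2"] p unfolding d by simp
    show "\<bar>d4\<bar> < x" using bt[of 0 "5 * b"] bt[of 1 "5 * b"] bt[of 2 "10 * b - 1"] bt[of 3 1] p unfolding d by simp
  qed
  note z0 = digit_eq_0[OF eq' bd(1)]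
  note z1 = digit_eq_0[OF z0(2) bd(2)]
  note z2 = digit_eq_0[OF z1(2) bd(3)]
  note z3 = digit_eq_0[OF z2(2) bd(4)]
  note z4 = digit_eq_0[OF z3(2) bd(5)]
  have e1: "\<beta> 1 = \<beta> 0" using z4(2) by (simp add: d)
  have "\<beta> 0 \<in> {-1, 0, 1}" "\<beta> 2 \<in> {-1, 0, 1}" "\<beta> 3 \<in> {-1, 0, 1}" using \<beta> len by auto
  \<comment> \<open>With \<open>e1\<close>, the digit \<open>d4\<close> gives 10 b (\<beta> 0 -
    \<beta> 2) = \<beta> 3 - \<beta> 2. The right side is at most 2 in absolute value, so both sides
    are 0.\<close>
  then have e23: "\<beta> 2 = \<beta> 0 \<and> \<beta> 3 = \<beta> 0"
    using z4(1) b_pos unfolding d e1 by auto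
  \<comment> \<open>The digit \<open>d0\<close> now says that \<open>R\<close> is \<beta> 0 times
    the sum of the constants, so subtracting \<beta> 0 from every coefficient gives a vanishing
    combination.\<close>
  have "(\<Sum>k<length ds. (\<beta> (k + 4) - \<beta> 0) * ds ! k) = R - \<beta> 0 * sum_list ds"
    by (simp add: R_def left_diff_distrib sum_subtractf sum_list_sum_nth sum_distrib_left atLeast0LessThan)
  also have "\<dots> = 0" using z0(1) e1 e23 unfolding d sum_ds by (simp add: algebra_simps)
  finally have "\<forall>k<length ds. \<beta> (k + 4) - \<beta> 0 = 0"
    using lacunary pos \<beta>_le[of 0] \<beta>_le[of "_ + 4"]
    by (intro lacunary_sum_eq_0) (fastforce simp: ds_def)+
  then have "\<beta> k = \<beta> 0" if "k < length ds + 4" for k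
  proof (cases "k < 4")
    case True
    then have "k \<in> {0, 1, 2, 3}" by auto
    then show ?thesis using e1 e23 by auto
  next
    case False
    then show ?thesis using that \<open>\<forall>k<length ds. \<beta> (k + 4) - \<beta> 0 = 0\<close>[rule_format, of "k - 4"] by simp
  qed
  then show False using ij len by (metis zero_neq_one)
qed

text \<open>Every entry except \<open>s\<close> is coprime to \<open>b\<close> or to
  \<open>L\<close>, both multiples of \<open>f\<close>. The entry \<open>s\<close> is -1 or -2
  modulo \<open>f\<close>, which \<open>f \<ge> 3\<close> keeps from being 0.\<close>

lemma tuple_not_dvd:
  assumes x: "[x = 1] (mod modulus)" and f: "f \<ge> 3" "f dvd L" and y: "y \<in> set (tuple x)"
  shows "\<not> f dvd y"
proof
  assume fy: "f dvd y"
  have "f dvd b" using f L_dvd_b by (meson dvd_trans)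
  have no: "\<not> f dvd z" if "coprime z L \<or> coprime z b" for z
    using that f \<open>f dvd b\<close> coprime_common_divisor[of z _ f] by auto
  note cb = tuple_coprime_b[OF x]
  have "y = s"
    using y fy cb cs_coprime_L no[of y] by (auto simp: tuple_def)
  then have "f dvd (if even k then -1 else -2)"
    using fy s_cong f(2) by (meson cong_dvd_iff cong_dvd_modulus)
  then show False using f(1) zdvd_imp_le[of f 2] zdvd_imp_le[of f 1] by (auto split: if_splits)
qed

lemma tuple_in_U_tuples:
  assumes "[x = 1] (mod modulus)" and "x > 1000 * b ^ 6"
    and "\<forall>f\<in>F. f \<ge> 3 \<and> int f dvd L"
  shows "tuple x \<in> U_tuples F (k + 6)"
  using sorted_coprime_tuple[OF assms(1)] no_vanishing_subsum_tuple[OF assms(2)]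
    tuple_not_dvd[OF assms(1)]
    assms(3) length_tuple sum_list_tuple
  by (auto simp: U_tuples_def pairwise_coprime_tuple_def sorted_wrt_iff_nth_less coprime_iff_gcd_eq_1)

end

section \<open>Radicals and lower bounds for the limit superior\<close>

lemma squarefree_dvd_power_imp_dvd:
  fixes d N :: int
  assumes "squarefree d" and "d dvd N ^ m"
  shows "d dvd N"
proof (cases "N = 0")
  case False
  have "d \<noteq> 0" using assms(1) by auto
  then show ?thesis
  proof (rule multiplicity_le_imp_dvd)
    fix p :: int assume p: "prime p"
    show "multiplicity p d \<le> multiplicity p N"
    proof (cases "p dvd d")
      case True
      then have "p dvd N" using p assms(2) by (meson dvd_trans prime_dvd_power)
      then have "multiplicity p N \<ge> 1"
        using p False
        by (metis less_one multiplicity_eq_zero_iff not_le not_prime_unit)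
      moreover have "multiplicity p d \<le> 1" using assms(1) p \<open>d \<noteq> 0\<close>
        by (metis squarefree_factorial_semiring'')
      ultimately show ?thesis by linarith
    qed (simp add: not_dvd_imp_multiplicity_0)
  qed
qed simp

lemma finite_squarefree_divisors:
  fixes N :: int
  assumes "N \<noteq> 0"
  shows "finite {d. d > 0 \<and> squarefree d \<and> d dvd N}"
  by (rule finite_subset[of _ "{1..\<bar>N\<bar>}"]) (use assms dvd_imp_le_int in force)+

text \<open>A squarefree divisor of a power of \<open>N\<close> divides \<open>N\<close> itself;
  this discards the high exponents in the product of the tuple.\<close>

lemma rad_le:
  assumes "a \<noteq> 0" and "N \<noteq> 0" and "a dvd N ^ m"
  shows "rad a \<le> \<bar>N\<bar>"
proof -
  have "d \<le> \<bar>N\<bar>" if "d > 0" "squarefree d" "d dvd a" for d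
    using squarefree_dvd_power_imp_dvd[OF that(2), of N m] that assms dvd_imp_le_int[of N d]
    by (auto intro: dvd_trans)
  moreover have "1 \<in> {d. d > 0 \<and> squarefree d \<and> d dvd a}" by simp
  ultimately show ?thesis
    unfolding rad_def using finite_squarefree_divisors[OF assms(1)] by (intro Max.boundedI) blast+
qed

lemma rad_gt_1:
  assumes "a \<noteq> 0" and "\<not> is_unit a"
  shows "rad a > 1"
proof -
  obtain p where p: "prime p" "p dvd a" using assms prime_divisor_exists by blast
  then have "p \<le> rad a"
    unfolding rad_def using finite_squarefree_divisors[OF assms(1)]
    by (intro Max_ge) (auto simp: prime_gt_0_int squarefree_prime)
  then show ?thesis using prime_gt_1_int[OF p(1)] by linarith
qed

text \<open>An injective sequence eventually leaves any finite set \<open>S\<close>, so the supremum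
  outside \<open>S\<close> still dominates \<open>h\<close> eventually, hence its limit.\<close>

lemma limsup_quality_ge:
  assumes "\<forall>\<^sub>F k in sequentially. t k \<in> A \<and> h k \<le> quality (t k)"
    and "inj t" and "h \<longlonglongrightarrow> l"
  shows "limsup_quality A \<ge> ereal l"
  unfolding limsup_quality_def
proof (rule INF_greatest)
  fix S assume "S \<in> {S. S \<subseteq> A \<and> finite S}"
  then have "finite (t -` S)" using assms(2) by (auto intro: finite_vimageI)
  then have "\<forall>\<^sub>F k in sequentially. t k \<notin> S"
    by (simp add: cofinite_eq_sequentially[symmetric] eventually_cofinite vimage_def)
  with assms(1) have "\<forall>\<^sub>F k in sequentially. ereal (h k) \<le> (SUP a\<in>A - S. ereal (quality a))"
  proof eventually_elim
    case (elim k)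
    then show ?case by (intro SUP_upper2[of "t k"]) auto
  qed
  moreover have "(\<lambda>k. ereal (h k)) \<longlonglongrightarrow> ereal l" using assms(3) by simp
  ultimately show "ereal l \<le> (SUP a\<in>A - S. ereal (quality a))"
    by (intro tendsto_upperbound) auto
qed

section \<open>Quality of the tuples and the limit 5/4\<close>

context tuple_parameters
begin

text \<open>The radical sees each base once, and x^4, a power of \<open>g\<close>, only through
  \<open>g\<close>. What remains is of order x^4 with a factor \<open>C\<close> independent of
  \<open>m\<close>, while the first entry is at least x^5.\<close>

lemma quality_tuple_ge:
  assumes x: "x = g ^ m" and g: "g > 1" and large: "x > 1000 * b ^ 6"
  defines "C \<equiv> 4 * (10 * b - 1) * g * (s * prod_list cs)"
  shows "5 * ln (real_of_int x) / (ln (real_of_int C) + 4 * ln (real_of_int x)) \<le> quality (tuple x)"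
proof -
  define P where "P = s * prod_list cs"
  define N where "N = (x + b) * (x - b) * (10 * b - 1) * g * (x ^ 2 + 10 * b ^ 3) * P"
  have "prod_list cs > 0" if "\<forall>c\<in>set cs. c > 0" for cs :: "int list" using that by (induction cs) auto
  then have P: "P > 0" using pos by (simp add: P_def)
  have "b ^ 1 \<le> b ^ 6" "b ^ 3 \<le> b ^ 6" using b_pos by (intro power_increasing; simp)+
  moreover have "b ^ 6 > 0" using b_pos by simp
  ultimately have xb: "x > b" "10 * b ^ 3 \<le> x" using large unfolding power_one_right by linarith+
  then have x1: "x > 1" using b_pos by simp
  then have "x * 1 \<le> x * x" by (intro mult_left_mono) auto
  then have w: "10 * b ^ 3 \<le> x ^ 2" using xb by (simp add: power2_eq_square)
  have w0: "x ^ 2 + 10 * b ^ 3 > 0" using x1 b_pos by (simp add: add_pos_pos)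
  have N: "N > 0" unfolding N_def using xb b_pos g P w0 by auto
  \<comment> \<open>Estimating x + b by 2 x and x^2 + 10 b^3 by 2 x^2 produces the factor 4 of
    \<open>C\<close>.\<close>
  have "N \<le> (2 * x) * x * (10 * b - 1) * g * (2 * x ^ 2) * P"
    unfolding N_def using xb b_pos g P w w0 x1
    by (intro mult_mono mult_nonneg_nonneg order_refl) auto
  also have "\<dots> = C * x ^ 4"
    by (simp add: C_def P_def algebra_simps power_numeral_reduce)
  finally have NC: "N \<le> C * x ^ 4" .
  have C: "C \<ge> 1" unfolding C_def P_def[symmetric] using b_pos g P by (simp add: int_one_le_iff_zero_less)
  have prod: "prod_list (tuple x) =
      - ((x + b) ^ 5 * (x - b) ^ 5 * ((10 * b - 1) * x ^ 4) * (x ^ 2 + 10 * b ^ 3) ^ 2 * P)"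
    by (simp add: tuple_def P_def mult.assoc)
  have nz: "prod_list (tuple x) \<noteq> 0"
    unfolding prod using xb w0 b_pos P x1 by auto
  \<comment> \<open>The exponent 5 + 4 m is a common bound for all exponents present, including the
    4 m of \<open>g\<close>.\<close>
  have "(x + b) ^ 5 * (x - b) ^ 5 * ((10 * b - 1) * x ^ 4) * (x ^ 2 + 10 * b ^ 3) ^ 2 * P
      dvd (x + b) ^ (5 + 4 * m) * (x - b) ^ (5 + 4 * m) * ((10 * b - 1) ^ (5 + 4 * m) * g ^ (5 + 4 * m)) *
        (x ^ 2 + 10 * b ^ 3) ^ (5 + 4 * m) * P ^ (5 + 4 * m)"
    unfolding x power_mult[symmetric]
    by (intro mult_dvd_mono le_imp_power_dvd) (auto simp: power_add)
  also have "\<dots> = N ^ (5 + 4 * m)"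
    by (simp add: N_def power_mult_distrib mult.assoc)
  finally have "rad (prod_list (tuple x)) \<le> \<bar>N\<bar>"
    using nz N by (intro rad_le[of _ _ "5 + 4 * m"]) (auto simp: prod)
  with NC N have radC: "rad (prod_list (tuple x)) \<le> C * x ^ 4" by simp
  have "x + b dvd prod_list (tuple x)" unfolding prod by (simp add: power_numeral_reduce mult.assoc)
  moreover have "\<not> is_unit (x + b)" using x1 b_pos by simp
  ultimately have rad1: "rad (prod_list (tuple x)) > 1"
    using nz dvd_trans by (intro rad_gt_1) blast+
  have "x ^ 5 \<le> (x + b) ^ 5" using x1 b_pos by (intro power_mono) auto
  also have "\<dots> \<le> \<bar>(x + b) ^ 5\<bar>" by simp
  also have "\<dots> \<le> Max (abs ` set (tuple x))" by (intro Max_ge) (auto simp: tuple_def)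
  finally have max: "x ^ 5 \<le> Max (abs ` set (tuple x))" .
  have "5 * ln (real_of_int x) = ln (real_of_int (x ^ 5))" using x1 by (simp add: ln_realpow)
  also have "\<dots> \<le> ln (real_of_int (Max (abs ` set (tuple x))))"
    using max x1 by (subst ln_le_cancel_iff) (auto simp del: of_int_power intro: less_le_trans[of 0 "x ^ 5"])
  finally have num: "5 * ln (real_of_int x) \<le> ln (real_of_int (Max (abs ` set (tuple x))))" .
  have "ln (real_of_int (rad (prod_list (tuple x)))) \<le> ln (real_of_int (C * x ^ 4))"
    using radC rad1 by (subst ln_le_cancel_iff) (auto simp del: of_int_power of_int_mult)
  also have "\<dots> = ln (real_of_int C) + 4 * ln (real_of_int x)"
    using C x1 by (simp add: ln_mult ln_realpow)
  finally have den: "ln (real_of_int (rad (prod_list (tuple x)))) \<le> \<dots>" .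
  show ?thesis
    unfolding quality_def using num den rad1 x1 by (intro frac_le) (auto intro: order_trans[OF _ num])
qed

lemma limsup_quality_ge_if_tuples:
  assumes "\<And>x. [x = 1] (mod modulus) \<Longrightarrow> x > 1000 * b ^ 6 \<Longrightarrow> tuple x \<in> A"
  shows "limsup_quality A \<ge> ereal (5 / 4)"
proof -
  \<comment> \<open>All powers of this \<open>g\<close> are 1 modulo \<open>modulus\<close>, so
    every sufficiently large power is an admissible \<open>x\<close>.\<close>
  define g where "g = 1 + modulus"
  define C where "C = 4 * (10 * b - 1) * g * (s * prod_list cs)"
  define h where "h m = 5 * ln (real_of_int (g ^ m)) / (ln (real_of_int C) + 4 * ln (real_of_int (g ^ m)))" for m
  have g: "g > 1" using b_pos pos by (auto simp: g_def modulus_def)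
  have "[g = 1] (mod modulus)" by (simp add: g_def cong_iff_dvd_diff)
  then have cong: "[g ^ m = 1] (mod modulus)" for m using cong_pow[of g 1 modulus m] by simp
  have "real_of_int g > 1" using g by simp
  then have "filterlim (\<lambda>m. real_of_int g ^ m) at_top sequentially" by real_asymp
  then have "\<forall>\<^sub>F m in sequentially. real_of_int g ^ m > real_of_int (1000 * b ^ 6)"
    by (simp add: filterlim_at_top_dense)
  then have "\<forall>\<^sub>F m in sequentially. tuple (g ^ m) \<in> A \<and> h m \<le> quality (tuple (g ^ m))"
  proof eventually_elim
    case (elim m)
    then have "g ^ m > 1000 * b ^ 6" by (metis of_int_less_iff of_int_power)
    then show ?case
      using assms[OF cong] quality_tuple_ge[OF refl g] unfolding h_def C_def by blast
  qed
  moreover have "inj (\<lambda>m. tuple (g ^ m))"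
  proof (rule injI)
    fix i j assume "tuple (g ^ i) = tuple (g ^ j)"
    then have "(g ^ i + b) ^ 5 = (g ^ j + b) ^ 5" by (simp add: tuple_def)
    then have "g ^ i + b = g ^ j + b"
      by (rule power_eq_imp_eq_base) (use g b_pos in auto)
    then show "i = j" using g by simp
  qed
  moreover have "h \<longlonglongrightarrow> 5 / 4"
  proof -
    have "ln (real_of_int g) > 0" using g by simp
    then have "(\<lambda>m. 5 * (real m * ln (real_of_int g)) /
        (ln (real_of_int C) + 4 * (real m * ln (real_of_int g)))) \<longlonglongrightarrow> 5 / 4"
      by real_asymp
    then show ?thesis using g by (simp add: h_def[abs_def] ln_realpow)
  qed
  ultimately show ?thesis by (rule limsup_quality_ge)
qed

end

lemma U_tuples_empty_subset_R_tuples: "U_tuples {} n \<subseteq> R_tuples n"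
  unfolding U_tuples_def R_tuples_def has_vanishing_subsum_def by blast

theorem theorem1p13:
  shows "(\<forall>n\<ge>6. \<forall>F :: nat set. finite F \<and> (F = {} \<or> Min F \<ge> 3) \<longrightarrow>
            limsup_quality (U_tuples F n) \<ge> ereal (5 / 4)) \<and>
         (\<forall>n\<ge>6. limsup_quality (R_tuples n) \<ge> ereal (5 / 4))"
proof -
  \<comment> \<open>Stating the bound for any superset of \<open>U_tuples F n\<close> covers
    \<open>U_tuples F n\<close> itself and, with \<open>F\<close> empty,
    \<open>R_tuples n\<close>.\<close>
  have main: "limsup_quality A \<ge> ereal (5 / 4)"
    if n: "n \<ge> 6" and F: "finite F" "F = {} \<or> Min F \<ge> 3" and A: "U_tuples F n \<subseteq> A"
    for n and F :: "nat set" and A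
  proof -
    have F3: "f \<ge> 3" if "f \<in> F" for f using that F Min_le[OF F(1) that] by (metis empty_iff order_trans)
    define L :: int where "L = 99990 * int (\<Prod>F)"
    have "\<Prod>F > 0" using F3 by (intro prod_pos) force
    then have "L > 0" by (simp add: L_def del: of_nat_prod)
    have "99990 dvd L" by (simp add: L_def)
    then obtain b s cs where "tuple_parameters L b s cs (n - 6)"
      using exists_tuple_parameters \<open>L > 0\<close> by blast
    then interpret tuple_parameters L b s cs "n - 6" .
    have "int f dvd L" if "f \<in> F" for f
      using that F(1) dvd_prodI[of F f "\<lambda>x. x"] unfolding L_def by (intro dvd_mult) (simp del: of_nat_prod)
    then have "tuple x \<in> A" if "[x = 1] (mod modulus)" "x > 1000 * b ^ 6" for x
      using tuple_in_U_tuples[OF that, of F] F3 A n by auto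
    then show ?thesis by (rule limsup_quality_ge_if_tuples)
  qed
  show ?thesis
    using main main[of _ "{}", OF _ _ _ U_tuples_empty_subset_R_tuples] by auto
qed

end
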